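(* Let $p,q,r\in\mathbb{C}$, let $f(x)=x^{3}+px^{2}+qx+r$, and let $D=-4q^{3}+p^{2}q^{2}+18pqr-4p^{3}r-27r^{2}$. Then: (1) $f$ has 3 distinct roots in $\mathbb{C}$ if and only if $D\neq 0$. (2) $f$ has 1 double root and 1 single root in $\mathbb{C}$ if and only if $D=0$ and $p^{2}-3q\neq 0$. (3) $f$ has a triple root in $\mathbb{C}$ if and only if $D=0$ and $p^{2}-3q=0$.
   Context: A single, double or triple root is a root of multiplicity exactly 1, 2 or 3, respectively. $D$ is the discriminant of the monic cubic $f$. *)

theory Defs
  imports Complex_Main "HOL-Computational_Algebra.Computational_Algebra"
begin

end

theory Submission
  imports Defs
begin

text \<open>
  Over \<open>\<complex>\<close> the cubic splits as \<open>(x - a) (x - b) (x - c)\<close>. Written in terms of the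
  roots, \<open>D\<close> is the classical discriminant \<open>((a - b) (b - c) (c - a))\<^sup>2\<close>, so it vanishes
  exactly when two roots coincide. If \<open>a = b\<close>, then \<open>p\<^sup>2 - 3 q\<close> collapses to
  \<open>(a - c)\<^sup>2\<close> and separates a double root from a triple one. As the multiplicity of a
  number is how often it occurs among \<open>a\<close>, \<open>b\<close>, \<open>c\<close>, all three equivalences can be read off
  from the coincidence pattern of the roots.
\<close>

lemma complex_cubic_splits:
  fixes p q r :: complex
  obtains a b c where "[:r, q, p, 1:] = [:-a, 1:] * [:-b, 1:] * [:-c, 1:]"
proof -
  have "\<not> constant (poly [:r, q, p, 1:])"
    by (simp add: constant_degree)
  then obtain a where "poly [:r, q, p, 1:] a = 0"
    using fundamental_theorem_of_algebra by blast
  then have r: "r = - a * (q + a * (p + a))"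
    by (simp add: eq_neg_iff_add_eq_0)
  \<comment> \<open>Division by \<open>x - a\<close> leaves this quadratic, with coefficients given by Horner's scheme.\<close>
  have "\<not> constant (poly [:q + a * (p + a), p + a, 1:])"
    by (simp add: constant_degree)
  then obtain b where "poly [:q + a * (p + a), p + a, 1:] b = 0"
    using fundamental_theorem_of_algebra by blast
  then have q: "q = - a * (p + a) - b * (p + a + b)"
    by (simp add: algebra_simps eq_neg_iff_add_eq_0)
  have "[:r, q, p, 1:] = [:-a, 1:] * [:-b, 1:] * [:-(- p - a - b), 1:]"
    by (simp add: r q algebra_simps)
  then show thesis by (rule that)
qed

lemma order_linear_factor:
  fixes a x :: "'a::field"
  shows "order x [:-a, 1:] = (if x = a then 1 else 0)"
  using order_power_n_n[of a 1] by (auto intro: order_0I)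

lemma order_cubic:
  fixes a b c x :: "'a::field"
  shows "order x ([:-a, 1:] * [:-b, 1:] * [:-c, 1:])
    = (if x = a then 1 else 0) + (if x = b then 1 else 0) + (if x = c then 1 else 0)"
  by (subst order_mult, simp, subst order_mult, simp) (simp only: order_linear_factor)

lemma cubic_discriminant_roots:
  fixes a b c p q r :: "'a::comm_ring_1"
  assumes "p = - a - b - c" "q = a * b + b * c + c * a" "r = - a * b * c"
  shows "- 4 * q ^ 3 + p\<^sup>2 * q\<^sup>2 + 18 * p * q * r - 4 * p ^ 3 * r - 27 * r\<^sup>2
    = ((a - b) * (b - c) * (c - a))\<^sup>2"
  unfolding assms by (simp add: algebra_simps power2_eq_square power3_eq_cube)

text \<open>
  The right-hand side is the symmetric expression
  \<open>a\<^sup>2 + b\<^sup>2 + c\<^sup>2 - a b - b c - c a\<close>, arranged so that, whichever two of the roots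
  coincide, one summand vanishes and the other is the square of the difference between
  the repeated root and the third one.
\<close>

lemma cubic_double_root_separation:
  fixes a b c p q :: "'a::comm_ring_1"
  assumes "p = - a - b - c" "q = a * b + b * c + c * a"
  shows "p\<^sup>2 - 3 * q = (a - c)\<^sup>2 + (b - a) * (b - c)"
  unfolding assms by (simp add: algebra_simps power2_eq_square power3_eq_cube)

theorem mainTheorem2:
  fixes p q r D :: complex and f :: "complex poly"
  assumes f_eq: "f = [:r, q, p, 1:]"
    and D_eq: "D = - 4 * q ^ 3 + p\<^sup>2 * q\<^sup>2 + 18 * p * q * r - 4 * p ^ 3 * r - 27 * r\<^sup>2"
  shows "(card {x. poly f x = 0} = 3 \<longleftrightarrow> D \<noteq> 0)
    \<and> (card {x. poly f x = 0 \<and> order x f = 2} = 1 \<and> card {x. poly f x = 0 \<and> order x f = 1} = 1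
          \<longleftrightarrow> D = 0 \<and> p\<^sup>2 - 3 * q \<noteq> 0)
    \<and> ((\<exists>x. poly f x = 0 \<and> order x f = 3) \<longleftrightarrow> D = 0 \<and> p\<^sup>2 - 3 * q = 0)"
proof -
  obtain a b c where split: "[:r, q, p, 1:] = [:-a, 1:] * [:-b, 1:] * [:-c, 1:]"
    by (rule complex_cubic_splits)
  have coeffs: "p = - a - b - c" "q = a * b + b * c + c * a" "r = - a * b * c"
    using split by (simp_all add: algebra_simps)
  have D: "D = ((a - b) * (b - c) * (c - a))\<^sup>2"
    unfolding D_eq by (rule cubic_discriminant_roots[OF coeffs])
  have P: "p\<^sup>2 - 3 * q = (a - c)\<^sup>2 + (b - a) * (b - c)"
    by (rule cubic_double_root_separation[OF coeffs(1,2)])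
  have root: "poly f x = 0 \<longleftrightarrow> x = a \<or> x = b \<or> x = c" for x
    unfolding f_eq split poly_mult by auto
  have roots: "{x. poly f x = 0} = {a, b, c}"
    by (auto simp: root)
  have ord: "order x f
    = (if x = a then 1 else 0) + (if x = b then 1 else 0) + (if x = c then 1 else 0)" for x
    unfolding f_eq split by (rule order_cubic)
  have pos: "poly f x = 0 \<and> order x f = k \<longleftrightarrow> order x f = k" if "k > 0" for x k
    using that by (auto simp: root ord)
  consider (distinct) "a \<noteq> b" "b \<noteq> c" "c \<noteq> a" | (ab) "a = b" "b \<noteq> c"
    | (bc) "b = c" "c \<noteq> a" | (ca) "c = a" "a \<noteq> b" | (triple) "a = b" "b = c"
    by blast
  then show ?thesis
  proof cases
    case distinct
    then have "{x. order x f = 2} = {}" and "\<not> (\<exists>x. order x f = 3)"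
      by (auto simp: ord)
    with distinct show ?thesis
      by (simp add: pos roots D)
  next
    case ab
    then have "{x. order x f = 2} = {a}" "{x. order x f = 1} = {c}" "\<not> (\<exists>x. order x f = 3)"
      by (auto simp: ord)
    with ab show ?thesis
      by (simp add: pos roots D P)
  next
    case bc
    then have "{x. order x f = 2} = {b}" "{x. order x f = 1} = {a}" "\<not> (\<exists>x. order x f = 3)"
      by (auto simp: ord)
    with bc show ?thesis
      by (simp add: pos roots D P)
  next
    case ca
    then have "{x. order x f = 2} = {c}" "{x. order x f = 1} = {b}" "\<not> (\<exists>x. order x f = 3)"
      by (auto simp: ord)
    with ca show ?thesis
      by (simp add: pos roots D P insert_commute)
  next
    case triple
    then have "{x. order x f = 2} = {}" "\<exists>x. order x f = 3"
      by (auto simp: ord)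
    with triple show ?thesis
      by (simp add: pos roots D P)
  qed
qed

end
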